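(* Let $K$ be a field which is quadratically closed with respect to $p$, where $p\in K\langle x_1,\dots,x_m\rangle$ is a multilinear polynomial. Then the image of $p$ evaluated on $M_2(K)$ is one of $\{0\}$, $K$ (the scalar matrices), $\operatorname{sl}_2(K)$, or $M_2(K)$.
   Context: A polynomial is multilinear if it has the form $\sum_{\sigma\in S_m}c_\sigma x_{\sigma(1)}\cdots x_{\sigma(m)}$. $K$ is quadratically closed with respect to $p$ if every nonconstant one-variable polynomial over $K$ of degree $\le 2\deg p$ has a root in $K$. $\operatorname{Im} p=\{p(a_1,\dots,a_m):a_i\in M_2(K)\}$, and $\operatorname{sl}_2(K)$ denotes the trace-zero $2\times 2$ matrices. *)

theory Defs
  imports "HOL-Analysis.Analysis" "HOL-Computational_Algebra.Polynomial"
begin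

text \<open>A multilinear polynomial p = sum over sigma in S_m of c_sigma x_{sigma(1)} ... x_{sigma(m)}
  in the free algebra K<x_1,...,x_m> is represented by m and the coefficient function c
  (only its values on permutations of {1..m} matter).\<close>

definition mat_prod_list :: "('a::semiring_1^'n^'n) list \<Rightarrow> 'a^'n^'n" where
  "mat_prod_list xs = foldr (\<lambda>A B. A ** B) xs (mat 1)"

definition ml_eval :: "nat \<Rightarrow> ((nat \<Rightarrow> nat) \<Rightarrow> 'a::field) \<Rightarrow> (nat \<Rightarrow> 'a^2^2) \<Rightarrow> 'a^2^2" where
  "ml_eval m c a =
     (\<Sum>\<sigma>\<in>{\<sigma>. \<sigma> permutes {1..m}}. mat (c \<sigma>) ** mat_prod_list (map (\<lambda>i. a (\<sigma> i)) [1..<m+1]))"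

text \<open>The polynomial is the zero element of the free algebra iff all coefficients vanish
  (distinct permutations give distinct monomials).\<close>
definition ml_nonzero :: "nat \<Rightarrow> ((nat \<Rightarrow> nat) \<Rightarrow> 'a::field) \<Rightarrow> bool" where
  "ml_nonzero m c \<longleftrightarrow> (\<exists>\<sigma>. \<sigma> permutes {1..m} \<and> c \<sigma> \<noteq> 0)"

text \<open>Quadratically closed w.r.t. p: every nonconstant one-variable polynomial of degree
  at most 2 deg p has a root. A nonzero multilinear p has degree m; for p = 0
  (degree -infinity) the condition is vacuous.\<close>
definition quad_closed_wrt :: "nat \<Rightarrow> ((nat \<Rightarrow> nat) \<Rightarrow> 'a::field) \<Rightarrow> bool" where
  "quad_closed_wrt m c \<longleftrightarrow>
     (ml_nonzero m c \<longrightarrow>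
        (\<forall>q :: 'a poly. 0 < degree q \<and> degree q \<le> 2 * m \<longrightarrow> (\<exists>x. poly q x = 0)))"

definition ml_image :: "nat \<Rightarrow> ((nat \<Rightarrow> nat) \<Rightarrow> 'a::field) \<Rightarrow> ('a^2^2) set" where
  "ml_image m c = {ml_eval m c a | a. True}"

end

theory Submission
  imports Defs
begin

text \<open>
  The image of p is closed under conjugation and scaling. Grade the 2 x 2 matrices by giving the
  matrix units e12 and e21 the weights 1 and -1; by multilinearity p maps homogeneous arguments of
  total weight w to weight w. If the (1,2) entry of p vanishes identically, conjugation shows that
  all values are scalar. Otherwise p(u) is a nonzero multiple of e12 for some homogeneous u. Let u*
  be u with the two basis vectors swapped, so that p(u*) is a multiple of e21. Arguments whose j-th
  entry lies on the line through u_j and u*_j have off-diagonal values by parity, and changing one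
  coordinate at a time from u to u* must at some point make a single coordinate sweep out the whole
  plane of off-diagonal matrices. Since nonscalar 2 x 2 matrices are conjugate as soon as trace and
  determinant agree, all nonscalar matrices of trace 0 are values.

  If the trace of p is not identically 0, fix d and consider the quadratic form
  det - d tr^2. It is nondegenerate on the off-diagonal plane, hence remains so on the plane swept
  out by the same coordinate after a perturbation of the remaining arguments for which the trace
  does not vanish on that coordinate. Solving quadratic equations there yields a nonscalar value
  with det = d tr^2 and tr nonzero, also in the case d = 1/4 of Jordan blocks.

  Scalar matrices come from a homogeneous v of weight 0: p(v) is diagonal with entries a, b, and
  either it is scalar or the path from v to v* sweeps out all diagonal matrices, unless a + b = 0.
\<close>

section \<open>Entries, scalar matrices and conjugacy of 2 x 2 matrices\<close>

lemma mat2_eqI: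
  fixes A B :: "'a^2^2"
  assumes "A$1$1 = B$1$1" "A$1$2 = B$1$2" "A$2$1 = B$2$1" "A$2$2 = B$2$2"
  shows "A = B"
  using assms by (simp add: vec_eq_iff forall_2)

lemma mat2_mult_nth:
  fixes A B :: "'a::semiring_1^2^2"
  shows "(A ** B)$i$j = A$i$1 * B$1$j + A$i$2 * B$2$j"
  by (simp add: matrix_matrix_mult_def sum_2)

lemma mat_mult_nth: "(mat k ** A)$i$j = (k::'a::semiring_1) * A$i$j"
  by (simp add: matrix_matrix_mult_def mat_def if_distrib [where f = "\<lambda>x. x * _"] cong: if_cong)

lemma mat_mult_left_commute:
  fixes A :: "'a::comm_semiring_1^'n^'n"
  shows "A ** (mat k ** B) = mat k ** (A ** B)"
proof -
  have "(A ** (mat k ** B))$i$j = (mat k ** (A ** B))$i$j" for i j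
    unfolding mat_mult_nth
    by (simp only: matrix_matrix_mult_def vec_lambda_beta mat_mult_nth [unfolded matrix_matrix_mult_def vec_lambda_beta])
       (simp add: sum_distrib_left mult_ac)
  then show ?thesis
    by (simp add: vec_eq_iff)
qed

lemma trace_mat2: "trace (A :: 'a::comm_semiring_1^2^2) = A$1$1 + A$2$2"
  by (simp add: trace_def sum_2)

definition mat2 :: "'a \<Rightarrow> 'a \<Rightarrow> 'a \<Rightarrow> 'a \<Rightarrow> 'a^2^2" where
  "mat2 a b c d = (\<chi> i j. if i = 1 then if j = 1 then a else b else if j = 1 then c else d)"

lemma mat2_nth [simp]:
  "mat2 a b c d $ 1 $ 1 = a" "mat2 a b c d $ 1 $ 2 = b"
  "mat2 a b c d $ 2 $ 1 = c" "mat2 a b c d $ 2 $ 2 = d"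
  by (simp_all add: mat2_def)

lemma mat_nth2: 
  "(mat k :: 'a::zero^2^2) $ 1 $ 1 = k" "(mat k :: 'a^2^2) $ 1 $ 2 = 0"
  "(mat k :: 'a^2^2) $ 2 $ 1 = 0" "(mat k :: 'a^2^2) $ 2 $ 2 = k"
  by (simp_all add: mat_def)

lemma scalar_mat2_iff:
  fixes M :: "'a::zero^2^2"
  shows "M \<in> range mat \<longleftrightarrow> M$1$2 = 0 \<and> M$2$1 = 0 \<and> M$1$1 = M$2$2"
  by (auto simp: mat_nth2 intro!: image_eqI [where x = "M$1$1"] mat2_eqI)

text \<open>A nonscalar \<open>M\<close> has a cyclic vector v. Taking v and M v as the columns of
  \<open>P\<close> gives the companion matrix, by Cayley-Hamilton.\<close>

lemma nonscalar_companion: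
  fixes M :: "'a::field^2^2"
  assumes "M \<notin> range mat"
  obtains P Q :: "'a^2^2" where "P ** Q = mat 1" "Q ** P = mat 1"
    "M = P ** mat2 0 (- det M) 1 (trace M) ** Q"
proof -
  obtain P :: "'a^2^2" where P: "det P \<noteq> 0" and MP: "M ** P = P ** mat2 0 (- det M) 1 (trace M)"
  proof -
    \<comment> \<open>The cyclic vector is e1, e2 or e1 + e2 respectively.\<close>
    consider "M$2$1 \<noteq> 0" | "M$2$1 = 0" "M$1$2 \<noteq> 0" | "M$2$1 = 0" "M$1$2 = 0" "M$1$1 \<noteq> M$2$2"
      using assms scalar_mat2_iff by blast
    then show thesis
    proof cases
      case 1
      then show thesis
        by (intro that [of "mat2 1 (M$1$1) 0 (M$2$1)"])
          (auto intro!: mat2_eqI simp: det_2 mat2_mult_nth trace_mat2 algebra_simps)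
    next
      case 2
      then show thesis
        by (intro that [of "mat2 0 (M$1$2) 1 (M$2$2)"])
          (auto intro!: mat2_eqI simp: det_2 mat2_mult_nth trace_mat2 algebra_simps)
    next
      case 3
      then show thesis
        by (intro that [of "mat2 1 (M$1$1) 1 (M$2$2)"])
          (auto intro!: mat2_eqI simp: det_2 mat2_mult_nth trace_mat2 algebra_simps)
    qed
  qed
  obtain Q where Q: "P ** Q = mat 1" "Q ** P = mat 1"
    using P invertible_det_nz unfolding invertible_def by blast
  have "M = M ** P ** Q"
    by (simp add: Q flip: matrix_mul_assoc)
  then show thesis
    using that Q MP by metis
qed

lemma nonscalar_conjugate:
  fixes M N :: "'a::field^2^2"
  assumes "M \<notin> range mat" "N \<notin> range mat" "trace M = trace N" "det M = det N"
  obtains P Q where "P ** Q = mat 1" "Q ** P = mat 1" "N = P ** M ** Q"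
proof -
  obtain P Q where PQ: "P ** Q = mat 1" "Q ** P = mat 1"
    "M = P ** mat2 0 (- det M) 1 (trace M) ** Q"
    using nonscalar_companion [OF assms(1)] .
  obtain P' Q' where PQ': "P' ** Q' = mat 1" "Q' ** P' = mat 1"
    "N = P' ** mat2 0 (- det M) 1 (trace M) ** Q'"
    using nonscalar_companion [OF assms(2)] assms(3,4) by metis
  define C where "C = mat2 0 (- det M) 1 (trace M)"
  have 1: "A ** P ** Q = A" "A ** Q ** P = A" "A ** P' ** Q' = A" "A ** Q' ** P' = A" for A
    using PQ(1,2) PQ'(1,2) by (simp_all flip: matrix_mul_assoc)
  show thesis
  proof
    show "(P' ** Q) ** (P ** Q') = mat 1"
      by (simp add: 1 matrix_mul_assoc PQ')
    show "(P ** Q') ** (P' ** Q) = mat 1"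
      by (simp add: 1 matrix_mul_assoc PQ)
    have "(P' ** Q) ** M ** (P ** Q') = (P' ** Q) ** (P ** C ** Q) ** (P ** Q')"
      using PQ(3) C_def by metis
    then show "N = (P' ** Q) ** M ** (P ** Q')"
      using PQ'(3) by (simp add: 1 matrix_mul_assoc C_def)
  qed
qed

section \<open>Conjugation equivariance and multilinearity of the evaluation\<close>

lemma mat_prod_list_simps [simp]:
  "mat_prod_list [] = mat 1" "mat_prod_list (x # xs) = x ** mat_prod_list xs"
  by (simp_all add: mat_prod_list_def)

lemma mat_prod_list_append: "mat_prod_list (xs @ ys) = mat_prod_list xs ** mat_prod_list ys"
  by (induction xs) (simp_all add: matrix_mul_assoc)

lemma mat_prod_list_conj:
  assumes "P ** Q = mat 1" "Q ** P = mat 1"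
  shows "mat_prod_list (map (\<lambda>x. P ** x ** Q) xs) = P ** mat_prod_list xs ** Q"
proof (induction xs)
  case (Cons x xs)
  have "P ** x ** Q ** (P ** mat_prod_list xs ** Q) = P ** x ** (Q ** P) ** mat_prod_list xs ** Q"
    by (simp add: matrix_mul_assoc)
  with Cons assms show ?case
    by (simp add: matrix_mul_assoc)
qed (simp add: assms)

lemma matrix_add_rdistrib: "(A + B) ** C = A ** C + B ** C"
  by (simp add: vec_eq_iff matrix_matrix_mult_def distrib_right sum.distrib)

lemma matrix_mul_sum_left: "A ** sum f S = (\<Sum>x\<in>S. A ** f x)"
  by (induction S rule: infinite_finite_induct) (simp_all add: matrix_add_ldistrib)

lemma matrix_mul_sum_right: "sum f S ** A = (\<Sum>x\<in>S. f x ** A)"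
  by (induction S rule: infinite_finite_induct) (simp_all add: matrix_add_rdistrib)

lemma ml_eval_cong:
  assumes "\<And>j. j \<in> {1..m} \<Longrightarrow> a j = b j"
  shows "ml_eval m c a = ml_eval m c b"
  unfolding ml_eval_def
proof (intro sum.cong refl arg_cong2 [where f = "(**)"] arg_cong [where f = mat_prod_list] map_cong)
  fix \<sigma> j
  assume "\<sigma> \<in> {\<sigma>. \<sigma> permutes {1..m}}" "j \<in> set [1..<m+1]"
  then have "\<sigma> j \<in> {1..m}"
    using permutes_in_image [of \<sigma> "{1..m}" j] by auto
  then show "a (\<sigma> j) = b (\<sigma> j)"
    by (rule assms)
qed

lemma ml_eval_conj:
  fixes P Q :: "'a::field^2^2"
  assumes "P ** Q = mat 1" "Q ** P = mat 1"
  shows "ml_eval m c (\<lambda>i. P ** a i ** Q) = P ** ml_eval m c a ** Q"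
proof -
  have "mat_prod_list (map (\<lambda>i. P ** a (\<sigma> i) ** Q) js) = P ** mat_prod_list (map (\<lambda>i. a (\<sigma> i)) js) ** Q"
    for \<sigma> and js :: "nat list"
    using mat_prod_list_conj [OF assms, of "map (\<lambda>i. a (\<sigma> i)) js"] by (simp add: o_def)
  then show ?thesis
    unfolding ml_eval_def
    by (simp add: matrix_mul_sum_left matrix_mul_sum_right mat_mult_left_commute [of P] matrix_mul_assoc [symmetric]
      del: upt_Suc)
qed

text \<open>The hypotheses make \<open>i\<close> occur exactly once in \<open>js\<close>, so exactly
  one factor of the product varies.\<close>

lemma mat_prod_list_linear:
  fixes x y :: "'a::comm_semiring_1^'n^'n"
  assumes "distinct js" "i \<in> set js"
  shows "mat_prod_list (map (a(i := mat k ** x + mat l ** y)) js) =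
    mat k ** mat_prod_list (map (a(i := x)) js) + mat l ** mat_prod_list (map (a(i := y)) js)"
proof -
  obtain ys zs where js: "js = ys @ i # zs"
    using assms(2) by (meson split_list)
  with assms(1) have "i \<notin> set ys" "i \<notin> set zs"
    by auto
  then have *: "map (a(i := z)) ys = map a ys" "map (a(i := z)) zs = map a zs" for z
    by auto
  show ?thesis
    by (simp add: js * mat_prod_list_append matrix_add_ldistrib matrix_add_rdistrib
        mat_mult_left_commute matrix_mul_assoc [symmetric])
qed

lemma ml_eval_linear:
  fixes x y :: "'a::field^2^2"
  assumes "i \<in> {1..m}"
  shows "ml_eval m c (a(i := mat k ** x + mat l ** y)) =
    mat k ** ml_eval m c (a(i := x)) + mat l ** ml_eval m c (a(i := y))"
proof -
  have "mat (c \<sigma>) ** mat_prod_list (map (\<lambda>j. (a(i := mat k ** x + mat l ** y)) (\<sigma> j)) [1..<m+1]) =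
     mat k ** (mat (c \<sigma>) ** mat_prod_list (map (\<lambda>j. (a(i := x)) (\<sigma> j)) [1..<m+1])) +
     mat l ** (mat (c \<sigma>) ** mat_prod_list (map (\<lambda>j. (a(i := y)) (\<sigma> j)) [1..<m+1]))"
    if "\<sigma> permutes {1..m}" for \<sigma>
  proof -
    define js where "js = map \<sigma> [1..<m+1]"
    have *: "map (\<lambda>j. b (\<sigma> j)) [1..<m+1] = map b js" for b :: "nat \<Rightarrow> 'a^2^2"
      by (simp add: js_def del: upt_Suc)
    have "{1..<m+1} = {1..m}" by auto
    then have "set js = {1..m}" "distinct js"
      using that unfolding js_def set_map set_upt distinct_map
      by (auto simp: permutes_image permutes_inj_on)
    then show ?thesis
      using assms unfolding * 
      by (simp add: mat_prod_list_linear matrix_add_ldistrib mat_mult_left_commute [of "mat (c \<sigma>)"] del: fun_upd_apply)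
  qed
  then show ?thesis
    unfolding ml_eval_def matrix_mul_sum_left sum.distrib [symmetric]
    by (intro sum.cong) blast+
qed

lemma ml_eval_add:
  fixes x y :: "'a::field^2^2"
  assumes "i \<in> {1..m}"
  shows "ml_eval m c (a(i := x + y)) = ml_eval m c (a(i := x)) + ml_eval m c (a(i := y))"
  using ml_eval_linear [OF assms, of c a 1 x 1 y] by simp

lemma ml_eval_scale:
  fixes x :: "'a::field^2^2"
  assumes "i \<in> {1..m}"
  shows "ml_eval m c (a(i := mat k ** x)) = mat k ** ml_eval m c (a(i := x))"
proof -
  have "mat 0 ** y = (0 :: 'a^2^2)" for y by (simp add: vec_eq_iff mat_mult_nth)
  then show ?thesis using ml_eval_linear [OF assms, of c a k x 0 x] by simp
qed

section \<open>Weights of matrices and homogeneous arguments\<close>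

definition unit_weight :: "2 \<Rightarrow> 2 \<Rightarrow> int" where
  "unit_weight i j = (if i = j then 0 else if i = 1 then 1 else - 1)"

text \<open>The weight is only prescribed modulo n. With n = 0 this is homogeneity for the integer grading
  in which e12 and e21 have weights 1 and -1; with n = 2 it separates diagonal from off-diagonal
  matrices.\<close>

definition homogeneous :: "int \<Rightarrow> int \<Rightarrow> 'a::zero^2^2 \<Rightarrow> bool" where
  "homogeneous n w M \<longleftrightarrow> (\<forall>i j. M$i$j \<noteq> 0 \<longrightarrow> n dvd unit_weight i j - w)"

lemma homogeneous_iff:
  "homogeneous n w M \<longleftrightarrow> (M$1$1 \<noteq> 0 \<longrightarrow> n dvd w) \<and> (M$2$2 \<noteq> 0 \<longrightarrow> n dvd w) \<and>
    (M$1$2 \<noteq> 0 \<longrightarrow> n dvd 1 - w) \<and> (M$2$1 \<noteq> 0 \<longrightarrow> n dvd - 1 - w)"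
  by (auto simp: homogeneous_def forall_2 unit_weight_def)

text \<open>A nonzero entry of the product needs nonzero entries at (i, k) and (k, j) for some k,
  and the weights of matrix units add along such a path.\<close>

lemma homogeneous_mult:
  fixes M N :: "'a::semiring_1^2^2"
  assumes "homogeneous n v M" "homogeneous n w N"
  shows "homogeneous n (v + w) (M ** N)"
  unfolding homogeneous_def
proof (intro allI impI)
  fix i j
  assume "(M ** N)$i$j \<noteq> 0"
  then obtain k where "M$i$k \<noteq> 0" "N$k$j \<noteq> 0"
    unfolding mat2_mult_nth by (metis add.right_neutral mult_zero_left mult_zero_right)
  then have "n dvd (unit_weight i k - v) + (unit_weight k j - w)"
    using assms unfolding homogeneous_def by (meson dvd_add)
  moreover have "unit_weight i j = unit_weight i k + unit_weight k j"
    using exhaust_2 [of i] exhaust_2 [of j] exhaust_2 [of k] by (auto simp: unit_weight_def)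
  ultimately show "n dvd unit_weight i j - (v + w)"
    by (simp add: algebra_simps)
qed

lemma homogeneous_add:
  fixes M N :: "'a::comm_monoid_add^2^2"
  shows "homogeneous n w M \<Longrightarrow> homogeneous n w N \<Longrightarrow> homogeneous n w (M + N)"
  by (auto simp: homogeneous_iff)

lemma homogeneous_0: "homogeneous n w 0"
  by (simp add: homogeneous_def)

lemma homogeneous_sum:
  fixes f :: "'b \<Rightarrow> 'a::comm_monoid_add^2^2"
  shows "(\<And>x. x \<in> S \<Longrightarrow> homogeneous n w (f x)) \<Longrightarrow> homogeneous n w (sum f S)"
  by (induction S rule: infinite_finite_induct) (simp_all add: homogeneous_0 homogeneous_add)

lemma homogeneous_mat: "homogeneous n 0 (mat k)"
  by (simp add: homogeneous_iff mat_nth2)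

lemma homogeneous_scale:
  fixes M :: "'a::semiring_1^2^2"
  shows "homogeneous n w M \<Longrightarrow> homogeneous n w (mat k ** M)"
  using homogeneous_mult [OF homogeneous_mat [of n k], of w M] by simp

lemma homogeneous_mat_prod_list:
  assumes "\<And>j. homogeneous n (w j) (a j)"
  shows "homogeneous n (\<Sum>j\<leftarrow>js. w j) (mat_prod_list (map a js))"
  by (induction js) (simp_all add: assms homogeneous_mult homogeneous_mat)

text \<open>Each monomial uses every argument once, so its total weight does not depend on the order
  of the factors.\<close>

lemma homogeneous_ml_eval:
  assumes "\<And>j. homogeneous n (w j) (a j)"
  shows "homogeneous n (\<Sum>j\<in>{1..m}. w j) (ml_eval m c a)"
  unfolding ml_eval_def
proof (intro homogeneous_sum homogeneous_scale)
  fix \<sigma>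
  assume "\<sigma> \<in> {\<sigma>. \<sigma> permutes {1..m}}"
  then have "(\<Sum>j\<in>{1..m}. w j) = (\<Sum>j\<in>{1..m}. w (\<sigma> j))"
    using sum.permute [of \<sigma> "{1..m}" w] by (simp add: o_def)
  moreover have "(\<Sum>j\<leftarrow>[1..<m+1]. w (\<sigma> j)) = (\<Sum>j\<in>set [1..<m+1]. w (\<sigma> j))"
    by (intro sum_list_distinct_conv_sum_set) simp
  moreover have "set [1..<m+1] = {1..m}"
    by auto
  ultimately have "(\<Sum>j\<in>{1..m}. w j) = (\<Sum>j\<leftarrow>[1..<m+1]. w (\<sigma> j))"
    by metis
  then show "homogeneous n (\<Sum>j\<in>{1..m}. w j) (mat_prod_list (map (\<lambda>j. a (\<sigma> j)) [1..<m+1]))"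
    using homogeneous_mat_prod_list [of n "\<lambda>j. w (\<sigma> j)" "\<lambda>j. a (\<sigma> j)"] assms by metis
qed

lemma homogeneous_decomposition:
  fixes M :: "'a::comm_monoid_add^2^2"
  obtains X Y Z where "homogeneous 0 0 X" "homogeneous 0 1 Y" "homogeneous 0 (- 1) Z" "M = X + Y + Z"
  by (rule that [of "mat2 (M$1$1) 0 0 (M$2$2)" "mat2 0 (M$1$2) 0 0" "mat2 0 0 (M$2$1) 0"])
     (auto simp: homogeneous_iff intro!: mat2_eqI)

text \<open>Applied in contrapositive form, with \<open>f\<close> an entry or the trace: multilinear
  expansion of a value where \<open>f\<close> is nonzero yields homogeneous arguments where it is
  nonzero.\<close>

lemma ml_eval_eq_0_if_homogeneous:
  fixes c :: "(nat \<Rightarrow> nat) \<Rightarrow> 'a::field" and f :: "'a^2^2 \<Rightarrow> 'a"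
  assumes f: "\<And>A B. f (A + B) = f A + f B"
    and hom: "\<And>w u. (\<And>j. homogeneous 0 (w j) (u j)) \<Longrightarrow> f (ml_eval m c u) = 0"
  shows "f (ml_eval m c a) = 0"
proof -
  \<comment> \<open>Induction on the number of leading arguments that may still be
    inhomogeneous.\<close>
  have "f (ml_eval m c a) = 0" if "n \<le> m" "\<And>j. j \<notin> {1..n} \<Longrightarrow> \<exists>w. homogeneous 0 w (a j)" for n a
    using that
  proof (induction n arbitrary: a)
    case 0
    then obtain w where "\<And>j. homogeneous 0 (w j) (a j)"
      by (simp; metis)
    then show ?case
      by (rule hom)
  next
    case (Suc n)
    let ?i = "Suc n"
    obtain X Y Z where XYZ: "homogeneous 0 0 X" "homogeneous 0 1 Y" "homogeneous 0 (- 1) Z" "a ?i = X + Y + Z"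
      using homogeneous_decomposition [of "a ?i"] .
    have i: "?i \<in> {1..m}"
      using Suc.prems by simp
    have 0: "f (ml_eval m c (a(?i := U))) = 0" if "homogeneous 0 w U" for w U
      using Suc that by (intro Suc.IH) auto
    have "a = a(?i := X + Y + Z)"
      using XYZ by auto
    then have "f (ml_eval m c a) = f (ml_eval m c (a(?i := X + Y + Z)))"
      by simp
    also have "\<dots> = 0"
      using XYZ 0 by (simp add: ml_eval_add [OF i] f del: fun_upd_apply)
    finally show ?case .
  qed
  note * = this [of m]
  \<comment> \<open>Arguments outside \<open>{1..m}\<close> do not affect the value; setting them to
    0 makes them homogeneous.\<close>
  define b where "b = (\<lambda>j. if j \<in> {1..m} then a j else 0)"
  have "ml_eval m c a = ml_eval m c b"
    by (rule ml_eval_cong) (simp add: b_def)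
  moreover have "\<exists>w. homogeneous 0 w (b j)" if "j \<notin> {1..m}" for j
    using that homogeneous_0 by (auto simp: b_def)
  ultimately show ?thesis
    using * [of b] by simp
qed

section \<open>Pairs of multiaffine functions\<close>

lemma finite_affine_zeros:
  fixes a b :: "'a::field"
  assumes "(1 - y) * a + y * b \<noteq> 0"
  shows "finite {x. (1 - x) * a + x * b = 0}"
proof -
  have "(1 - x) * a + x * b = poly [:a, b - a:] x" for x
    by (simp add: algebra_simps)
  moreover from this have "[:a, b - a:] \<noteq> 0"
    using assms by (metis poly_0)
  ultimately show ?thesis
    using poly_roots_finite [of "[:a, b - a:]"] by simp
qed

text \<open>The pairs (a, b), (c, d), (e, f) are successively proportional; transitivity would fail
  through a zero pair in the middle.\<close>

lemma proportional_trans: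
  fixes a :: "'a::field"
  assumes "a * d = c * b" "c * f = e * d" "c \<noteq> 0 \<or> d \<noteq> 0"
  shows "a * f = e * b"
proof -
  have "c * (a * f) = c * (e * b)" "d * (a * f) = d * (e * b)"
    using assms(1,2) by algebra+
  with assms(3) show ?thesis
    by auto
qed

text \<open>Any two points at which the pair does not vanish are joined by a path along which one
  coordinate changes at a time and the pair never vanishes: move both ends to a common generic
  value of one coordinate and recurse.\<close>

lemma multiaffine_pair_proportional:
  fixes A B :: "(nat \<Rightarrow> 'a::field) \<Rightarrow> 'a"
  assumes inf: "infinite (UNIV :: 'a set)" and "finite I"
    and A: "\<And>s i x. i \<in> I \<Longrightarrow> A (s(i := x)) = (1 - x) * A (s(i := 0)) + x * A (s(i := 1))"
    and B: "\<And>s i x. i \<in> I \<Longrightarrow> B (s(i := x)) = (1 - x) * B (s(i := 0)) + x * B (s(i := 1))"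
    and adj: "\<And>s i. i \<in> I \<Longrightarrow> A (s(i := 0)) * B (s(i := 1)) = A (s(i := 1)) * B (s(i := 0))"
    and "\<And>j. j \<notin> I \<Longrightarrow> s j = t j"
  shows "A s * B t = A t * B s"
  using assms(2-)
proof (induction I arbitrary: s t rule: finite_induct)
  case empty
  then have "s = t" by auto
  then show ?case by simp
next
  case (insert i I)
  obtain a0 a1 b0 b1 where AB: "\<And>r x. A (r(i := x)) = (1 - x) * a0 r + x * a1 r"
      "\<And>r x. B (r(i := x)) = (1 - x) * b0 r + x * b1 r" and ab: "\<And>r. a0 r * b1 r = a1 r * b0 r"
    by (rule that [of "\<lambda>r. A (r(i := 0))" "\<lambda>r. A (r(i := 1))" "\<lambda>r. B (r(i := 0))" "\<lambda>r. B (r(i := 1))"])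
       (rule insert.prems(1-3), rule insertI1)+
  have AB_self: "A r = (1 - r i) * a0 r + r i * a1 r" "B r = (1 - r i) * b0 r + r i * b1 r" for r
    using AB [of r "r i"] by simp_all
  have gen: "finite {x. A (r(i := x)) = 0 \<and> B (r(i := x)) = 0}" if "A r \<noteq> 0 \<or> B r \<noteq> 0" for r
    using that
  proof
    assume "A r \<noteq> 0"
    then have "finite {x. A (r(i := x)) = 0}"
      unfolding AB using finite_affine_zeros [of "r i" "a0 r" "a1 r"] AB_self(1) [of r] by simp
    then show ?thesis by (rule rev_finite_subset) auto
  next
    assume "B r \<noteq> 0"
    then have "finite {x. B (r(i := x)) = 0}"
      unfolding AB using finite_affine_zeros [of "r i" "b0 r" "b1 r"] AB_self(2) [of r] by simp
    then show ?thesis by (rule rev_finite_subset) auto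
  qed
  \<comment> \<open>By \<open>ab\<close> the pairs at 0 and 1 are proportional, so all pairs along
    this coordinate lie on one line through the origin.\<close>
  have line: "A r * B (r(i := x)) = A (r(i := x)) * B r" for r x
    unfolding AB AB_self [of r] using ab [of r] by algebra
  show ?case
  proof (cases "(A s \<noteq> 0 \<or> B s \<noteq> 0) \<and> (A t \<noteq> 0 \<or> B t \<noteq> 0)")
    case True
    then have "finite ({x. A (s(i := x)) = 0 \<and> B (s(i := x)) = 0} \<union> {x. A (t(i := x)) = 0 \<and> B (t(i := x)) = 0})"
      using gen by simp
    \<comment> \<open>A common value of coordinate \<open>i\<close> that keeps both pairs nonzero;
      the two new points agree outside \<open>I\<close>, as the induction hypothesis
      requires.\<close>
    then obtain x where x: "A (s(i := x)) \<noteq> 0 \<or> B (s(i := x)) \<noteq> 0" "A (t(i := x)) \<noteq> 0 \<or> B (t(i := x)) \<noteq> 0"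
      using ex_new_if_finite [OF inf] by blast
    have st: "A (s(i := x)) * B (t(i := x)) = A (t(i := x)) * B (s(i := x))"
    proof (rule insert.IH)
      show "(s(i := x)) j = (t(i := x)) j" if "j \<notin> I" for j
        using insert.prems(4) [of j] that by auto
    qed (rule insert.prems(1-3); rule insertI2; assumption)+
    show ?thesis
      by (rule proportional_trans [OF proportional_trans [OF line st x(1)] line [symmetric] x(2)])
  next
    case False
    then show ?thesis by auto
  qed
qed

section \<open>The quadratic form det - d tr^2\<close>

text \<open>\<open>disc\<close> makes \<open>Q\<close> nondegenerate on the span of \<open>X\<close>
  and \<open>Y\<close>. Solving quadratic equations there gives isotropic matrices
  \<open>X1\<close>, \<open>X2\<close> that are not orthogonal. If both have trace 0, they serve to
  correct \<open>Z\<close> to an isotropic matrix of the same trace.\<close>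

lemma mat2_prescribed_ratio:
  fixes X Y Z :: "'a::field^2^2" and d :: 'a
  defines "Q \<equiv> \<lambda>M. det M - d * (trace M)\<^sup>2"
  assumes quad: "\<And>b c :: 'a. \<exists>x. x\<^sup>2 + b * x + c = 0"
    and Z: "trace Z \<noteq> 0"
    and disc: "(Q (X + Y) - Q X - Q Y)\<^sup>2 \<noteq> 4 * Q X * Q Y"
  obtains \<alpha> \<beta> \<gamma> M where "M = mat \<alpha> ** X + mat \<beta> ** Y + mat \<gamma> ** Z"
    "M \<notin> range mat" "trace M \<noteq> 0" "det M = d * (trace M)\<^sup>2"
proof -
  \<comment> \<open>The polar form of \<open>Q\<close>, not halved, so that characteristic 2 is
    covered.\<close>
  define b where "b = (\<lambda>M N. Q (M + N) - Q M - Q N)"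
  have Q: "Q M = M$1$1 * M$2$2 - M$1$2 * M$2$1 - d * (M$1$1 + M$2$2)\<^sup>2" for M
    by (simp add: Q_def det_2 trace_mat2)
  have b: "b M N = M$1$1 * N$2$2 + N$1$1 * M$2$2 - M$1$2 * N$2$1 - N$1$2 * M$2$1
      - 2 * d * (M$1$1 + M$2$2) * (N$1$1 + N$2$2)" for M N
    unfolding b_def Q by (simp; algebra)
  have Q_comb: "Q (M + mat t ** N) = Q M + t * b M N + t\<^sup>2 * Q N" for M N t
    unfolding b Q by (simp add: mat_mult_nth; algebra)
  have b_comb: "b (M + mat t ** N) L = b M L + t * b N L" for M N L t
    unfolding b by (simp add: mat_mult_nth; algebra)
  have b_comm: "b M N = b N M" for M N
    unfolding b by algebra
  have b_comb': "b L (M + mat t ** N) = b L M + t * b L N" for M N L t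
    using b_comb b_comm by metis
  have b_self: "b M M = 2 * Q M" for M
    unfolding b Q by algebra
  \<comment> \<open>Q(aI) = a^2 (1 - 4d) and b(aI, N) = a (1 - 4d) tr N, so an isotropic scalar
    matrix is orthogonal to everything, also for d = 1/4.\<close>
  have nonscalar: "M \<notin> range mat" if "Q M = 0" "b M N \<noteq> 0" for M N
  proof
    assume "M \<in> range mat"
    then have M: "M$1$2 = 0" "M$2$1 = 0" "M$1$1 = M$2$2"
      by (auto simp: scalar_mat2_iff)
    with that(1) have "M$2$2 * (1 - 4 * d) = 0"
      unfolding Q by (simp; algebra)
    then have "b M N = 0"
      unfolding b using M by (simp; algebra)
    with that show False by blast
  qed
  have disc': "(b X Y)\<^sup>2 \<noteq> 4 * Q X * Q Y"
    using disc by (simp add: b_def)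
  obtain \<alpha>1 \<beta>1 \<alpha>2 \<beta>2 X1 X2 where
    X1: "X1 = mat \<alpha>1 ** X + mat \<beta>1 ** Y" "Q X1 = 0" and
    X2: "X2 = mat \<alpha>2 ** X + mat \<beta>2 ** Y" "Q X2 = 0" and b12: "b X1 X2 \<noteq> 0"
  proof (cases "Q Y = 0")
    case True
    with disc' have bXY: "b X Y \<noteq> 0" by auto
    \<comment> \<open>As \<open>Y\<close> is isotropic, the equation Q(X + tY) = 0 is linear in
      t.\<close>
    define t where "t = - Q X / b X Y"
    have "Q (X + mat t ** Y) = 0"
      using True bXY by (simp add: Q_comb t_def)
    moreover have "b Y (X + mat t ** Y) \<noteq> 0"
      using bXY True by (simp add: b_comb' b_self b_comm [of Y X])
    ultimately show thesis
      using True by (intro that [of Y 0 1 "X + mat t ** Y" 1 t]) auto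
  next
    case False
    obtain t where "t\<^sup>2 + b X Y / Q Y * t + Q X / Q Y = 0"
      using quad by blast
    then have t: "Q Y * t\<^sup>2 + b X Y * t + Q X = 0"
      using False by (simp add: field_simps)
    \<comment> \<open>The other root, by Vieta.\<close>
    define t' where "t' = - b X Y / Q Y - t"
    have t'0: "Q Y * (t + t') = - b X Y"
      using False by (simp add: t'_def)
    then have t': "Q Y * t'\<^sup>2 + b X Y * t' + Q X = 0"
      using t by algebra
    \<comment> \<open>The right-hand side is minus the discriminant, so the two isotropic matrices
      are not orthogonal.\<close>
    have "Q Y * b (X + mat t ** Y) (X + mat t' ** Y) = 4 * Q X * Q Y - (b X Y)\<^sup>2"
    proof -
      have "b (X + mat t ** Y) (X + mat t' ** Y) = 2 * Q X + (t + t') * b X Y + 2 * t * t' * Q Y"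
        by (simp add: b_comb b_comb' b_self b_comm [of Y X] algebra_simps)
      then show ?thesis
        using t t'0 by algebra
    qed
    then have "b (X + mat t ** Y) (X + mat t' ** Y) \<noteq> 0"
      using disc' by auto
    moreover have "Q (X + mat t ** Y) = 0" "Q (X + mat t' ** Y) = 0"
      using t t' by (simp_all add: Q_comb algebra_simps)
    ultimately show thesis
      by (intro that [of "X + mat t ** Y" 1 t "X + mat t' ** Y" 1 t']) auto
  qed
  show thesis
  proof (cases "trace X1 = 0 \<and> trace X2 = 0")
    case False
    then show thesis
    proof (cases "trace X1 = 0")
      case True
      have "X2 \<notin> range mat"
        using nonscalar [of X2 X1] X2 b12 b_comm by metis
      with False True show thesis
        using X2 by (intro that [of X2 \<alpha>2 \<beta>2 0]) (auto simp: Q_def)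
    next
      case False
      have "X1 \<notin> range mat"
        using nonscalar [of X1 X2] X1 b12 by metis
      with False show thesis
        using X1 by (intro that [of X1 \<alpha>1 \<beta>1 0]) (auto simp: Q_def)
    qed
  next
    case True
    \<comment> \<open>\<open>t\<close> achieves b(Z + t X2, X1) = 1. Since \<open>X1\<close> is
      isotropic, adding s X1 then changes \<open>Q\<close> by exactly s, and \<open>s\<close> is
      chosen to cancel Q(Z + t X2).\<close>
    define t where "t = (1 - b Z X1) / b X1 X2"
    define s where "s = - (Q Z + t * b Z X2)"
    define M where "M = Z + mat t ** X2 + mat s ** X1"
    have bM: "b (Z + mat t ** X2) X1 = 1"
      using b12 by (simp add: b_comb t_def b_comm [of X2 X1])
    have "Q M = 0"
      by (simp add: M_def Q_comb bM X1 X2 s_def flip: X1(1) X2(1))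
    moreover have "b M X1 = 1"
      by (simp add: M_def b_comb [of "Z + mat t ** X2"] bM b_self X1 flip: X1(1))
    ultimately have "M \<notin> range mat"
      using nonscalar [of M X1] by simp
    moreover have "trace M = trace Z"
    proof -
      have "trace M = trace Z + t * trace X2 + s * trace X1"
        unfolding M_def trace_mat2 by (simp add: mat_mult_nth algebra_simps)
      with True show ?thesis by simp
    qed
    moreover have "M = mat (t * \<alpha>2 + s * \<alpha>1) ** X + mat (t * \<beta>2 + s * \<beta>1) ** Y + mat 1 ** Z"
      unfolding M_def X1 X2 by (simp add: vec_eq_iff mat_mult_nth algebra_simps)
    ultimately show thesis
      using Z \<open>Q M = 0\<close>
      by (intro that [of M "t * \<alpha>2 + s * \<alpha>1" "t * \<beta>2 + s * \<beta>1" 1]) (simp_all add: Q_def)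
  qed
qed

section \<open>Polynomial functions of one parameter\<close>

definition poly_fun :: "('a::comm_ring_1 \<Rightarrow> 'a) \<Rightarrow> bool" where
  "poly_fun f \<longleftrightarrow> (\<exists>q. \<forall>x. f x = poly q x)"

lemma poly_fun_const: "poly_fun (\<lambda>x. k)"
  unfolding poly_fun_def by (rule exI [of _ "[:k:]"]) simp

lemma poly_fun_id: "poly_fun (\<lambda>x. x)"
  unfolding poly_fun_def by (rule exI [of _ "[:0, 1:]"]) simp

lemma poly_fun_add: "poly_fun f \<Longrightarrow> poly_fun g \<Longrightarrow> poly_fun (\<lambda>x. f x + g x)"
  unfolding poly_fun_def by (metis poly_add)

lemma poly_fun_diff: "poly_fun f \<Longrightarrow> poly_fun g \<Longrightarrow> poly_fun (\<lambda>x. f x - g x)"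
  unfolding poly_fun_def by (metis poly_diff)

lemma poly_fun_mult: "poly_fun f \<Longrightarrow> poly_fun g \<Longrightarrow> poly_fun (\<lambda>x. f x * g x)"
  unfolding poly_fun_def by (metis poly_mult)

lemma poly_fun_power: "poly_fun f \<Longrightarrow> poly_fun (\<lambda>x. f x ^ n)"
  unfolding poly_fun_def by (metis poly_power)

lemma poly_fun_sum: "(\<And>y. y \<in> S \<Longrightarrow> poly_fun (f y)) \<Longrightarrow> poly_fun (\<lambda>x. \<Sum>y\<in>S. f y x)"
  by (induction S rule: infinite_finite_induct) (simp_all add: poly_fun_const poly_fun_add)

lemmas poly_fun_intros =
  poly_fun_const poly_fun_id poly_fun_add poly_fun_diff poly_fun_mult poly_fun_power

text \<open>The perturbation argument: both zero sets are finite, so a generic parameter avoids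
  them.\<close>

lemma poly_fun_common_nonzero:
  fixes f g :: "'a::field \<Rightarrow> 'a"
  assumes "infinite (UNIV :: 'a set)" "poly_fun f" "poly_fun g" "f x0 \<noteq> 0" "g x1 \<noteq> 0"
  obtains x where "f x \<noteq> 0" "g x \<noteq> 0"
proof -
  obtain p q where pq: "\<And>x. f x = poly p x" "\<And>x. g x = poly q x"
    using assms(2,3) unfolding poly_fun_def by blast
  with assms(4,5) have "p \<noteq> 0" "q \<noteq> 0"
    by auto
  then have "finite ({x. f x = 0} \<union> {x. g x = 0})"
    by (simp add: pq poly_roots_finite)
  with that show thesis
    using ex_new_if_finite [OF assms(1)] by blast
qed

lemma poly_fun_ml_eval:
  fixes a :: "'a::field \<Rightarrow> nat \<Rightarrow> 'a^2^2"
  assumes "\<And>j i k. poly_fun (\<lambda>x. a x j $ i $ k)"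
  shows "poly_fun (\<lambda>x. ml_eval m c (a x) $ i $ k)"
proof -
  have *: "poly_fun (\<lambda>x. mat_prod_list (map (a x) js) $ i $ k)" for js i k
  proof (induction js arbitrary: i k)
    case Nil
    then show ?case by (simp add: poly_fun_const)
  next
    case (Cons j js)
    then show ?case
      by (simp add: mat2_mult_nth poly_fun_add poly_fun_mult assms)
  qed
  have "poly_fun (\<lambda>x. mat_prod_list (map (\<lambda>j. a x (\<sigma> j)) js) $ i $ k)" for \<sigma> and js :: "nat list"
    using * [of "map \<sigma> js"] by (simp add: o_def)
  then show ?thesis
    unfolding ml_eval_def sum_component mat_mult_nth
    by (intro poly_fun_sum poly_fun_mult poly_fun_const)
qed

section \<open>Closure properties of the image\<close>

lemma ml_image_conj:
  assumes "P ** Q = mat 1" "Q ** P = mat 1" "M \<in> ml_image m c"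
  shows "P ** M ** Q \<in> ml_image m c"
  using assms(3) ml_eval_conj [OF assms(1,2), symmetric] unfolding ml_image_def by blast

lemma ml_image_scale:
  assumes "m \<ge> 1" "M \<in> ml_image m c"
  shows "mat k ** M \<in> ml_image m c"
proof -
  obtain a where "M = ml_eval m c a"
    using assms(2) by (auto simp: ml_image_def)
  moreover have "mat k ** ml_eval m c a = ml_eval m c (a(1 := mat k ** a 1))"
    using assms(1) ml_eval_scale [of 1 m c a k "a 1"] by simp
  ultimately show ?thesis
    unfolding ml_image_def by blast
qed

text \<open>Values whose arguments differ in one coordinate only can be added, by linearity in it. A
  single moving coordinate thus sweeps out a subspace.\<close>

lemma ml_image_comb:
  fixes x y z :: "'a::field^2^2"
  assumes "i \<in> {1..m}"
  shows "mat \<alpha> ** ml_eval m c (a(i := x)) + mat \<beta> ** ml_eval m c (a(i := y)) +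
    mat \<gamma> ** ml_eval m c (a(i := z)) \<in> ml_image m c"
proof -
  have "mat \<alpha> ** ml_eval m c (a(i := x)) + mat \<beta> ** ml_eval m c (a(i := y)) +
      mat \<gamma> ** ml_eval m c (a(i := z)) = ml_eval m c (a(i := mat \<alpha> ** x + mat \<beta> ** y + mat \<gamma> ** z))"
    by (simp only: ml_eval_add [OF assms] ml_eval_scale [OF assms])
  then show ?thesis
    unfolding ml_image_def by blast
qed

text \<open>The multiple of \<open>M\<close> by \<open>k\<close> has the trace and determinant of
  \<open>N\<close>, hence is conjugate to it.\<close>

lemma ml_image_nonscalar:
  fixes M N :: "'a::field^2^2"
  assumes "m \<ge> 1" "M \<in> ml_image m c" "M \<notin> range mat" "N \<notin> range mat"
    "trace N = k * trace M" "det N = k\<^sup>2 * det M" "k \<noteq> 0"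
  shows "N \<in> ml_image m c"
proof -
  have "mat k ** M \<notin> range mat"
    using assms(3,7) by (simp add: scalar_mat2_iff mat_mult_nth)
  moreover have "trace (mat k ** M) = trace N" "det (mat k ** M) = det N"
    using assms(5,6) by (simp_all add: trace_mat2 det_2 mat_mult_nth power2_eq_square algebra_simps)
  ultimately obtain P Q where "P ** Q = mat 1" "Q ** P = mat 1" "N = P ** (mat k ** M) ** Q"
    using nonscalar_conjugate assms(4) by metis
  then show ?thesis
    using ml_image_conj ml_image_scale [OF assms(1,2)] by metis
qed

section \<open>Single coordinates that sweep out a plane\<close>

text \<open>Swapping the basis vectors exchanges the positions (k, l) and (k', l'). Between u and
  its flip the pair of entries there turns into its swap, and by \<open>ne\<close> these are not
  proportional. So \<open>multiaffine_pair_proportional\<close> must fail on some edge, where one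
  coordinate changes the direction of the pair.\<close>

lemma flip_family:
  fixes c :: "(nat \<Rightarrow> nat) \<Rightarrow> 'a::field" and k l k' l' :: 2
  assumes inf: "infinite (UNIV :: 'a set)" and kl: "k \<noteq> k'" "l \<noteq> l'"
    and hom: "\<And>j. homogeneous 0 (w j) (u j)"
    and ne: "(ml_eval m c u $ k $ l)\<^sup>2 \<noteq> (ml_eval m c u $ k' $ l')\<^sup>2"
  obtains a i x y where "i \<in> {1..m}"
    "homogeneous 2 (\<Sum>j\<in>{1..m}. w j) (ml_eval m c (a(i := x)))"
    "homogeneous 2 (\<Sum>j\<in>{1..m}. w j) (ml_eval m c (a(i := y)))"
    "ml_eval m c (a(i := x)) $ k $ l * ml_eval m c (a(i := y)) $ k' $ l' \<noteq>
     ml_eval m c (a(i := y)) $ k $ l * ml_eval m c (a(i := x)) $ k' $ l'"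
proof -
  define J :: "'a^2^2" where "J = mat2 0 1 1 0"
  have J: "J ** J = mat 1"
    by (auto intro!: mat2_eqI simp: J_def mat2_mult_nth mat_nth2)
  have flip: "(J ** M ** J)$1$1 = M$2$2" "(J ** M ** J)$1$2 = M$2$1" "(J ** M ** J)$2$1 = M$1$2" "(J ** M ** J)$2$2 = M$1$1" for M
    by (simp_all add: J_def mat2_mult_nth)
  have flip_nth: "(J ** M ** J)$k$l = M$k'$l'" "(J ** M ** J)$k'$l' = M$k$l" for M
    using kl exhaust_2 [of k] exhaust_2 [of k'] exhaust_2 [of l] exhaust_2 [of l'] flip by auto
  define v where "v j = J ** u j ** J" for j
  \<comment> \<open>Flipping negates the weight, which is invisible modulo 2.\<close>
  have hom2: "homogeneous 2 (w j) (u j)" "homogeneous 2 (w j) (v j)" for j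
    using hom [of j] by (auto simp: homogeneous_iff v_def flip) presburger+
  define g where "g s j = mat (1 - s j) ** u j + mat (s j) ** v j" for s :: "nat \<Rightarrow> 'a" and j
  have hom_g: "homogeneous 2 (w j) (g s j)" for s j
    by (simp add: g_def homogeneous_add homogeneous_scale hom2)
  define A where "A s = ml_eval m c (g s) $ k $ l" for s
  define B where "B s = ml_eval m c (g s) $ k' $ l'" for s
  have g_upd: "g (s(i := x)) = (g s)(i := mat (1 - x) ** u i + mat x ** v i)" for s i x
    by (auto simp: g_def)
  have g01: "g (s(i := 0)) = (g s)(i := u i)" "g (s(i := 1)) = (g s)(i := v i)" for s i
    by (simp_all add: g_upd)
  have A_upd: "A (s(i := x)) = (1 - x) * A (s(i := 0)) + x * A (s(i := 1))" if "i \<in> {1..m}" for s i x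
    unfolding A_def g_upd [of s i x] g01 ml_eval_linear [OF that] by (simp add: mat_mult_nth)
  have B_upd: "B (s(i := x)) = (1 - x) * B (s(i := 0)) + x * B (s(i := 1))" if "i \<in> {1..m}" for s i x
    unfolding B_def g_upd [of s i x] g01 ml_eval_linear [OF that] by (simp add: mat_mult_nth)
  \<comment> \<open>The value 0 outside \<open>{1..m}\<close> makes \<open>t\<close> agree there
    with the starting point.\<close>
  define t :: "nat \<Rightarrow> 'a" where "t j = (if j \<in> {1..m} then 1 else 0)" for j
  have "g (\<lambda>_. 0) = u"
    by (simp add: g_def fun_eq_iff)
  moreover have "ml_eval m c (g t) = J ** ml_eval m c u ** J"
    unfolding ml_eval_conj [OF J J, symmetric]
    by (rule ml_eval_cong) (simp add: g_def t_def v_def)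
  ultimately have "A (\<lambda>_. 0) * B t \<noteq> A t * B (\<lambda>_. 0)"
    using ne by (simp add: A_def B_def flip_nth power2_eq_square)
  moreover have "A (\<lambda>_. 0) * B t = A t * B (\<lambda>_. 0)"
    if "\<And>s i. i \<in> {1..m} \<Longrightarrow> A (s(i := 0)) * B (s(i := 1)) = A (s(i := 1)) * B (s(i := 0))"
    by (rule multiaffine_pair_proportional [OF inf, of "{1..m}"])
       (rule A_upd B_upd that finite_atLeastAtMost | simp add: t_def)+
  ultimately obtain s i where i: "i \<in> {1..m}"
    and AB: "A (s(i := 0)) * B (s(i := 1)) \<noteq> A (s(i := 1)) * B (s(i := 0))"
    by blast
  show thesis
  proof
    show "homogeneous 2 (\<Sum>j\<in>{1..m}. w j) (ml_eval m c ((g s)(i := u i)))"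
      by (rule homogeneous_ml_eval) (simp add: hom_g hom2)
    show "homogeneous 2 (\<Sum>j\<in>{1..m}. w j) (ml_eval m c ((g s)(i := v i)))"
      by (rule homogeneous_ml_eval) (simp add: hom_g hom2)
  qed (use i AB in \<open>simp_all add: A_def B_def g01\<close>)
qed

lemma ml_eval_offdiagonal_pair:
  fixes c :: "(nat \<Rightarrow> nat) \<Rightarrow> 'a::field"
  assumes inf: "infinite (UNIV :: 'a set)" and "ml_eval m c a0 $ 1 $ 2 \<noteq> 0"
  obtains a i x y where "i \<in> {1..m}"
    "ml_eval m c (a(i := x)) $ 1 $ 1 = 0" "ml_eval m c (a(i := x)) $ 2 $ 2 = 0"
    "ml_eval m c (a(i := y)) $ 1 $ 1 = 0" "ml_eval m c (a(i := y)) $ 2 $ 2 = 0"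
    "ml_eval m c (a(i := x)) $ 1 $ 2 * ml_eval m c (a(i := y)) $ 2 $ 1 \<noteq>
     ml_eval m c (a(i := y)) $ 1 $ 2 * ml_eval m c (a(i := x)) $ 2 $ 1"
proof -
  obtain w u where hom: "\<And>j. homogeneous 0 (w j) (u j)" and u: "ml_eval m c u $ 1 $ 2 \<noteq> 0"
    using ml_eval_eq_0_if_homogeneous [of "\<lambda>M. M $ 1 $ 2" m c a0] assms(2) by auto
  have "homogeneous 0 (\<Sum>j\<in>{1..m}. w j) (ml_eval m c u)"
    by (rule homogeneous_ml_eval) (rule hom)
  \<comment> \<open>In the integer grading a nonzero (1,2) entry forces total weight 1, which
    excludes a (2,1) entry.\<close>
  then have W: "(\<Sum>j\<in>{1..m}. w j) = 1" and "ml_eval m c u $ 2 $ 1 = 0"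
    using u by (auto simp: homogeneous_iff)
  then have "(ml_eval m c u $ 1 $ 2)\<^sup>2 \<noteq> (ml_eval m c u $ 2 $ 1)\<^sup>2"
    using u by simp
  then obtain a i x y where axy: "i \<in> {1..m}"
    "homogeneous 2 (\<Sum>j\<in>{1..m}. w j) (ml_eval m c (a(i := x)))"
    "homogeneous 2 (\<Sum>j\<in>{1..m}. w j) (ml_eval m c (a(i := y)))"
    "ml_eval m c (a(i := x)) $ 1 $ 2 * ml_eval m c (a(i := y)) $ 2 $ 1 \<noteq>
     ml_eval m c (a(i := y)) $ 1 $ 2 * ml_eval m c (a(i := x)) $ 2 $ 1"
    by (rule flip_family [where w = w and u = u, OF inf _ _ hom, rotated 2]) simp_all
  show thesis
    \<comment> \<open>Odd weight modulo 2 leaves no diagonal entries.\<close>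
    using axy(2,3) unfolding W by (intro that [OF axy(1) _ _ _ _ axy(4)]) (simp_all add: homogeneous_iff)
qed

lemma linear_system_2_solvable:
  fixes a b c d :: "'a::field"
  assumes "a * d \<noteq> b * c"
  obtains \<alpha> \<beta> where "\<alpha> * a + \<beta> * b = s" "\<alpha> * c + \<beta> * d = t"
proof
  show "(d * s - b * t) / (a * d - b * c) * a + (a * t - c * s) / (a * d - b * c) * b = s"
    "(d * s - b * t) / (a * d - b * c) * c + (a * t - c * s) / (a * d - b * c) * d = t"
    using assms by (simp_all add: divide_simps) (simp_all add: algebra_simps)
qed

section \<open>Nonscalar and scalar values\<close>

text \<open>The off-diagonal plane contains the matrix with (1,2) entry 1 and (2,1) entry
  \<open>- det N\<close>, which shares trace and determinant with \<open>N\<close>.\<close>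

lemma ml_image_trace_0:
  fixes c :: "(nat \<Rightarrow> nat) \<Rightarrow> 'a::field"
  assumes "infinite (UNIV :: 'a set)" "m \<ge> 1" "ml_eval m c a0 $ 1 $ 2 \<noteq> 0"
    and N: "N \<notin> range mat" "trace N = 0"
  shows "N \<in> ml_image m c"
proof -
  obtain a i x y where i: "i \<in> {1..m}" and
    0: "ml_eval m c (a(i := x)) $ 1 $ 1 = 0" "ml_eval m c (a(i := x)) $ 2 $ 2 = 0"
    "ml_eval m c (a(i := y)) $ 1 $ 1 = 0" "ml_eval m c (a(i := y)) $ 2 $ 2 = 0" and
    ne: "ml_eval m c (a(i := x)) $ 1 $ 2 * ml_eval m c (a(i := y)) $ 2 $ 1 \<noteq>
     ml_eval m c (a(i := y)) $ 1 $ 2 * ml_eval m c (a(i := x)) $ 2 $ 1"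
    using ml_eval_offdiagonal_pair [OF assms(1,3)] .
  define X where "X = ml_eval m c (a(i := x))"
  define Y where "Y = ml_eval m c (a(i := y))"
  obtain \<alpha> \<beta> where ab: "\<alpha> * X$1$2 + \<beta> * Y$1$2 = 1" "\<alpha> * X$2$1 + \<beta> * Y$2$1 = - det N"
    using linear_system_2_solvable [OF ne, of 1 "- det N"] unfolding X_def Y_def .
  define M where "M = mat \<alpha> ** X + mat \<beta> ** Y + mat 0 ** X"
  have M: "M \<in> ml_image m c"
    unfolding M_def X_def Y_def by (rule ml_image_comb [OF i])
  have "M$1$1 = 0" "M$2$2 = 0" "M$1$2 = 1" "M$2$1 = - det N"
    using 0 ab unfolding M_def X_def [symmetric] Y_def [symmetric] by (simp_all add: mat_mult_nth)
  then show ?thesis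
    using N by (intro ml_image_nonscalar [OF assms(2) M, of N 1])
      (auto simp: scalar_mat2_iff trace_mat2 det_2 [of M])
qed

text \<open>By scaling and conjugation, one nonscalar value with nonzero trace and the same ratio
  det / tr^2 as \<open>N\<close> suffices.\<close>

lemma ml_image_trace_nonzero:
  fixes c :: "(nat \<Rightarrow> nat) \<Rightarrow> 'a::field"
  assumes inf: "infinite (UNIV :: 'a set)" and quad: "\<And>b c :: 'a. \<exists>x. x\<^sup>2 + b * x + c = 0"
    and m: "m \<ge> 1" and "ml_eval m c a0 $ 1 $ 2 \<noteq> 0" and b: "trace (ml_eval m c b) \<noteq> 0"
    and N: "N \<notin> range mat" "trace N \<noteq> 0"
  shows "N \<in> ml_image m c"
proof -
  obtain a i x y where i: "i \<in> {1..m}" and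
    0: "ml_eval m c (a(i := x)) $ 1 $ 1 = 0" "ml_eval m c (a(i := x)) $ 2 $ 2 = 0"
    "ml_eval m c (a(i := y)) $ 1 $ 1 = 0" "ml_eval m c (a(i := y)) $ 2 $ 2 = 0" and
    ne: "ml_eval m c (a(i := x)) $ 1 $ 2 * ml_eval m c (a(i := y)) $ 2 $ 1 \<noteq>
     ml_eval m c (a(i := y)) $ 1 $ 2 * ml_eval m c (a(i := x)) $ 2 $ 1"
    using ml_eval_offdiagonal_pair [OF assms(1,4)] .
  define d where "d = det N / (trace N)\<^sup>2"
  define Q where "Q M = det M - d * (trace M)\<^sup>2" for M :: "'a^2^2"
  define disc where "disc M L = (Q (M + L) - Q M - Q L)\<^sup>2 - 4 * Q M * Q L" for M L
  \<comment> \<open>The remaining arguments move from those of the off-diagonal plane at s = 0 to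
    \<open>b\<close> at s = 1, while coordinate \<open>i\<close> takes the values \<open>x\<close>,
    \<open>y\<close> and \<open>b i\<close>.\<close>
  define g where "g s j = mat (1 - s) ** a j + mat s ** b j" for s j
  define X where "X s = ml_eval m c ((g s)(i := x))" for s
  define Y where "Y s = ml_eval m c ((g s)(i := y))" for s
  define Z where "Z s = ml_eval m c ((g s)(i := b i))" for s
  have g_poly: "poly_fun (\<lambda>s. ((g s)(i := z)) j $ p $ q)" for z j p q
    by (cases "j = i") (simp_all add: g_def mat_mult_nth poly_fun_intros)
  have XYZ_poly: "poly_fun (\<lambda>s. X s $ p $ q)" "poly_fun (\<lambda>s. Y s $ p $ q)" "poly_fun (\<lambda>s. Z s $ p $ q)" for p q
    unfolding X_def Y_def Z_def by (rule poly_fun_ml_eval [OF g_poly])+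
  have "poly_fun (\<lambda>s. disc (X s) (Y s))"
    unfolding disc_def Q_def det_2 trace_mat2 vector_add_component
    by (intro poly_fun_intros XYZ_poly)
  moreover have "poly_fun (\<lambda>s. trace (Z s))"
    unfolding trace_mat2 by (intro poly_fun_intros XYZ_poly)
  \<comment> \<open>At s = 0 all traces vanish, so d drops out and the discriminant is the square of
    the determinant in \<open>ne\<close>.\<close>
  moreover have "disc (X 0) (Y 0) \<noteq> 0"
  proof -
    have "g 0 = a"
      by (simp add: g_def fun_eq_iff)
    then have XY: "X 0 $ 1 $ 1 = 0" "X 0 $ 2 $ 2 = 0" "Y 0 $ 1 $ 1 = 0" "Y 0 $ 2 $ 2 = 0"
      "X 0 $ 1 $ 2 * Y 0 $ 2 $ 1 - Y 0 $ 1 $ 2 * X 0 $ 2 $ 1 \<noteq> 0"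
      using 0 ne by (simp_all add: X_def Y_def)
    have "disc (X 0) (Y 0) = (X 0 $ 1 $ 2 * Y 0 $ 2 $ 1 - Y 0 $ 1 $ 2 * X 0 $ 2 $ 1)\<^sup>2"
      unfolding disc_def Q_def det_2 trace_mat2 vector_add_component XY(1-4)
      by (simp add: power2_eq_square algebra_simps)
    with XY(5) show ?thesis
      by simp
  qed
  moreover have "trace (Z 1) \<noteq> 0"
  proof -
    have "(g 1)(i := b i) = b"
      by (auto simp: g_def)
    with b show ?thesis
      by (simp add: Z_def)
  qed
  ultimately obtain s where s: "disc (X s) (Y s) \<noteq> 0" "trace (Z s) \<noteq> 0"
    by (rule poly_fun_common_nonzero [OF inf])
  have disc_ne: "(Q (X s + Y s) - Q (X s) - Q (Y s))\<^sup>2 \<noteq> 4 * Q (X s) * Q (Y s)"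
    using s(1) by (simp add: disc_def)
  obtain \<alpha> \<beta> \<gamma> M where M: "M = mat \<alpha> ** X s + mat \<beta> ** Y s + mat \<gamma> ** Z s"
    "M \<notin> range mat" "trace M \<noteq> 0" "det M = d * (trace M)\<^sup>2"
    using mat2_prescribed_ratio [OF quad s(2) disc_ne [unfolded Q_def]] .
  have "M \<in> ml_image m c"
    unfolding M(1) X_def Y_def Z_def by (rule ml_image_comb [OF i])
  then show ?thesis
    using M(2-4) N by (intro ml_image_nonscalar [OF m _ _ _, of M c N "trace N / trace M"])
      (simp_all add: d_def power_divide)
qed

lemma ml_image_scalar:
  fixes c :: "(nat \<Rightarrow> nat) \<Rightarrow> 'a::field"
  assumes inf: "infinite (UNIV :: 'a set)" and m: "m \<ge> 1" and b: "trace (ml_eval m c b) \<noteq> 0"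
  shows "mat k \<in> ml_image m c"
proof -
  obtain w v where hom: "\<And>j. homogeneous 0 (w j) (v j)" and v: "trace (ml_eval m c v) \<noteq> 0"
    using ml_eval_eq_0_if_homogeneous [of trace m c b] b by (auto simp: trace_add)
  define V where "V = ml_eval m c v"
  have "homogeneous 0 (\<Sum>j\<in>{1..m}. w j) V"
    unfolding V_def by (rule homogeneous_ml_eval) (rule hom)
  \<comment> \<open>A nonzero trace needs a nonzero diagonal entry, which forces total weight
    0.\<close>
  then have W: "(\<Sum>j\<in>{1..m}. w j) = 0" and "V $ 1 $ 2 = 0" "V $ 2 $ 1 = 0"
    using v unfolding V_def [symmetric]
    by (auto simp: homogeneous_iff trace_mat2)
  show ?thesis
  proof (cases "V$1$1 = V$2$2")
    case True
    then have "V$2$2 \<noteq> 0"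
      using v by (auto simp: V_def trace_mat2)
    have "mat (k / V$2$2) ** V = mat k"
      using \<open>V$2$2 \<noteq> 0\<close> \<open>V$1$2 = 0\<close> \<open>V$2$1 = 0\<close> True
      by (auto intro!: mat2_eqI simp: mat_mult_nth mat_nth2)
    moreover have "V \<in> ml_image m c"
      by (auto simp: V_def ml_image_def)
    ultimately show ?thesis
      using ml_image_scale [OF m] by metis
  next
    case False
    \<comment> \<open>Sum and difference of the diagonal entries are nonzero, so their squares
      differ and \<open>flip_family\<close> applies to the diagonal positions.\<close>
    have "V$1$1 + V$2$2 \<noteq> 0"
      using v by (simp add: V_def trace_mat2)
    with False have "(V$1$1)\<^sup>2 \<noteq> (V$2$2)\<^sup>2"
      by (auto simp: power2_eq_iff)
    then obtain a i x y where i: "i \<in> {1..m}" and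
      hom2: "homogeneous 2 (\<Sum>j\<in>{1..m}. w j) (ml_eval m c (a(i := x)))"
        "homogeneous 2 (\<Sum>j\<in>{1..m}. w j) (ml_eval m c (a(i := y)))" and
      ne: "ml_eval m c (a(i := x)) $ 1 $ 1 * ml_eval m c (a(i := y)) $ 2 $ 2 \<noteq>
       ml_eval m c (a(i := y)) $ 1 $ 1 * ml_eval m c (a(i := x)) $ 2 $ 2"
      unfolding V_def by (rule flip_family [where w = w and u = v, OF inf _ _ hom, rotated 2]) simp_all
    define X where "X = ml_eval m c (a(i := x))"
    define Y where "Y = ml_eval m c (a(i := y))"
    have "X$1$2 = 0" "X$2$1 = 0" "Y$1$2 = 0" "Y$2$1 = 0"
      using hom2 unfolding X_def [symmetric] Y_def [symmetric] W by (auto simp: homogeneous_iff)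
    moreover obtain \<alpha> \<beta> where "\<alpha> * X$1$1 + \<beta> * Y$1$1 = k" "\<alpha> * X$2$2 + \<beta> * Y$2$2 = k"
      using linear_system_2_solvable [OF ne, of k k] unfolding X_def Y_def .
    ultimately have "mat \<alpha> ** X + mat \<beta> ** Y + mat 0 ** X = mat k"
      by (intro mat2_eqI) (simp_all add: mat_mult_nth mat_nth2)
    moreover have "mat \<alpha> ** X + mat \<beta> ** Y + mat 0 ** X \<in> ml_image m c"
      unfolding X_def Y_def by (rule ml_image_comb [OF i])
    ultimately show ?thesis
      by simp
  qed
qed

text \<open>The condition on \<open>k\<close> leaves k = 0 or characteristic 2. In the latter case a
  diagonal matrix of trace 0 is scalar, so a homogeneous choice with nonzero (1,1) entry is
  enough.\<close>

lemma ml_image_scalar_trace_0: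
  fixes c :: "(nat \<Rightarrow> nat) \<Rightarrow> 'a::field"
  assumes m: "m \<ge> 1" and a0: "ml_eval m c a0 $ 1 $ 2 \<noteq> 0"
    and tr: "\<And>a. trace (ml_eval m c a) = 0" and k: "k + k = 0"
  shows "mat k \<in> ml_image m c"
proof (cases "k = 0")
  case True
  then show ?thesis
    using ml_image_scale [OF m, of "ml_eval m c a0" c 0]
    by (auto simp: ml_image_def vec_eq_iff mat_mult_nth)
next
  case False
  have char2: "x + x = 0" for x :: 'a
  proof -
    have "x + x = x / k * (k + k)"
      using False by (simp add: field_simps)
    with k show ?thesis by (metis mult_zero_right)
  qed
  \<comment> \<open>Conjugation by this shear subtracts the (1,2) entry from the (1,1) entry, so the
    latter cannot vanish identically.\<close>
  define P Q :: "'a^2^2" where "P = mat2 1 0 1 1" and "Q = mat2 1 0 (- 1) 1"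
  have PQ: "P ** Q = mat 1" "Q ** P = mat 1"
    by (auto intro!: mat2_eqI simp: P_def Q_def mat2_mult_nth mat_nth2)
  have conj: "ml_eval m c (\<lambda>i. P ** a0 i ** Q) $ 1 $ 1 = ml_eval m c a0 $ 1 $ 1 - ml_eval m c a0 $ 1 $ 2"
    unfolding ml_eval_conj [OF PQ] by (simp add: P_def Q_def mat2_mult_nth)
  have "\<not> (\<forall>a. ml_eval m c a $ 1 $ 1 = 0)"
  proof
    assume "\<forall>a. ml_eval m c a $ 1 $ 1 = 0"
    with conj a0 show False
      by simp
  qed
  then obtain a where "ml_eval m c a $ 1 $ 1 \<noteq> 0"
    by blast
  then obtain w v where hom: "\<And>j. homogeneous 0 (w j) (v j)" and v: "ml_eval m c v $ 1 $ 1 \<noteq> 0"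
    using ml_eval_eq_0_if_homogeneous [of "\<lambda>M. M $ 1 $ 1" m c a] by auto
  define V where "V = ml_eval m c v"
  have "homogeneous 0 (\<Sum>j\<in>{1..m}. w j) V"
    unfolding V_def by (rule homogeneous_ml_eval) (rule hom)
  then have "V $ 1 $ 2 = 0" "V $ 2 $ 1 = 0"
    using v unfolding V_def [symmetric]
    by (auto simp: homogeneous_iff)
  moreover have "V$2$2 = V$1$1"
    using tr [of v] char2 [of "V$1$1"] by (metis V_def trace_mat2 add_left_cancel)
  ultimately have "mat (k / V$1$1) ** V = mat k"
    using v unfolding V_def [symmetric] by (intro mat2_eqI) (simp_all add: mat_mult_nth mat_nth2)
  moreover have "V \<in> ml_image m c"
    by (auto simp: V_def ml_image_def)
  ultimately show ?thesis
    using ml_image_scale [OF m] by metis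
qed

text \<open>Conjugates of a value are values. The swap moves the (2,1) entry to position (1,2); a
  shear then puts the difference of the diagonal entries there.\<close>

lemma ml_eval_scalar:
  fixes c :: "(nat \<Rightarrow> nat) \<Rightarrow> 'a::field"
  assumes "\<And>a. ml_eval m c a $ 1 $ 2 = 0"
  shows "ml_eval m c a \<in> range mat"
proof -
  define M where "M = ml_eval m c a"
  have *: "(P ** M ** Q) $ 1 $ 2 = 0" if "P ** Q = mat 1" "Q ** P = mat 1" for P Q :: "'a^2^2"
    using assms ml_eval_conj [OF that] unfolding M_def by metis
  have "M $ 1 $ 2 = 0"
    using assms by (simp add: M_def)
  moreover have "M $ 2 $ 1 = 0"
    using * [of "mat2 0 1 1 0" "mat2 0 1 1 0"] by (simp add: vec_eq_iff forall_2 mat2_mult_nth mat_nth2)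
  moreover have "M $ 2 $ 2 = M $ 1 $ 1"
    using * [of "mat2 1 1 0 1" "mat2 1 (- 1) 0 1"] calculation
    by (simp add: vec_eq_iff forall_2 mat2_mult_nth mat_nth2)
  ultimately show ?thesis
    by (simp add: scalar_mat2_iff M_def)
qed

section \<open>Infinity of the field and the final case distinction\<close>

text \<open>Solving quadratics makes x^2 - x surjective, yet it sends both 0 and 1 to 0; on a finite
  field this is impossible.\<close>

lemma infinite_if_quadratic_roots:
  assumes "\<And>b c :: 'a::field. \<exists>x. x\<^sup>2 + b * x + c = 0"
  shows "infinite (UNIV :: 'a set)"
proof
  assume "finite (UNIV :: 'a set)"
  moreover have "surj (\<lambda>x :: 'a. x\<^sup>2 - x)"
  proof (rule surjI)
    fix y :: 'a
    have "\<exists>x. x\<^sup>2 - x = y"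
      using assms [of "- 1" "- y"] by simp
    then show "(SOME x. x\<^sup>2 - x = y)\<^sup>2 - (SOME x. x\<^sup>2 - x = y) = y"
      by (rule someI_ex)
  qed
  ultimately have inj: "inj (\<lambda>x :: 'a. x\<^sup>2 - x)"
    using finite_UNIV_surj_inj by blast
  show False
    using injD [OF inj, of 0 1] by simp
qed

theorem theorem2p2:
  fixes m :: nat and c :: "(nat \<Rightarrow> nat) \<Rightarrow> 'a::field"
  assumes "m \<ge> 1"
    and "quad_closed_wrt m c"
  shows "ml_image m c = {0} \<or> ml_image m c = range mat \<or>
         ml_image m c = {A :: 'a^2^2. trace A = 0} \<or> ml_image m c = UNIV"
proof (cases "ml_nonzero m c")
  case False
  then have "ml_eval m c a = 0" for a
    by (auto simp: ml_nonzero_def ml_eval_def vec_eq_iff mat_mult_nth intro!: sum.neutral)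
  then show ?thesis
    by (simp add: ml_image_def)
next
  case True
  \<comment> \<open>Degree 2 is within the bound 2m because m \<ge> 1.\<close>
  have quad: "\<exists>x. x\<^sup>2 + b * x + d = 0" for b d :: 'a
  proof -
    have "degree [:d, b, 1:] = 2"
      by simp
    then have "0 < degree [:d, b, 1:] \<and> degree [:d, b, 1:] \<le> 2 * m"
      using assms(1) by simp
    then obtain x where "poly [:d, b, 1:] x = 0"
      using True assms(2) unfolding quad_closed_wrt_def by blast
    then show ?thesis
      by (intro exI [of _ x]) (simp add: algebra_simps power2_eq_square)
  qed
  note inf = infinite_if_quadratic_roots [OF quad]
  show ?thesis
  proof (cases "\<forall>a. ml_eval m c a $ 1 $ 2 = 0")
    case True
    then have scalar: "ml_eval m c a \<in> range mat" for a
      by (intro ml_eval_scalar) blast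
    then have sub: "ml_image m c \<subseteq> range mat"
      unfolding ml_image_def by blast
    \<comment> \<open>Multiples of a single nonzero scalar value reach every scalar matrix.\<close>
    have "ml_image m c = range mat" if a: "ml_eval m c a \<noteq> 0" for a
    proof -
      obtain e where e: "ml_eval m c a = mat e"
        using scalar by blast
      with a have "e \<noteq> 0"
        by auto
      have "mat k \<in> ml_image m c" for k
      proof -
        have "mat (k / e) ** ml_eval m c a = mat k"
          unfolding e using \<open>e \<noteq> 0\<close> by (intro mat2_eqI) (simp_all add: mat_mult_nth mat_nth2)
        moreover have "mat (k / e) ** ml_eval m c a \<in> ml_image m c"
          by (rule ml_image_scale [OF assms(1)]) (auto simp: ml_image_def)
        ultimately show ?thesis
          by simp
      qed
      with sub show ?thesis
        by blast
    qed
    moreover have "ml_image m c = {0}" if "\<forall>a. ml_eval m c a = 0"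
      using that by (simp add: ml_image_def)
    ultimately show ?thesis
      by blast
  next
    case False
    then obtain a0 where a0: "ml_eval m c a0 $ 1 $ 2 \<noteq> 0"
      by blast
    show ?thesis
    proof (cases "\<forall>a. trace (ml_eval m c a) = 0")
      case True
      have "N \<in> ml_image m c" if N: "trace N = 0" for N
      proof (cases "N \<in> range mat")
        case True
        then obtain k where "N = mat k"
          by blast
        with N \<open>\<forall>a. trace (ml_eval m c a) = 0\<close> show ?thesis
          using ml_image_scalar_trace_0 [OF assms(1) a0, of k] by (simp add: trace_mat2 mat_nth2)
      next
        case False
        then show ?thesis
          using ml_image_trace_0 [OF inf assms(1) a0] N by blast
      qed
      then have "ml_image m c = {A. trace A = 0}"
        using True by (auto simp: ml_image_def)
      then show ?thesis
        by blast
    next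
      case False
      then obtain b where b: "trace (ml_eval m c b) \<noteq> 0"
        by blast
      have "N \<in> ml_image m c" for N
      proof (cases "N \<in> range mat")
        case True
        then show ?thesis
          using ml_image_scalar [OF inf assms(1) b] by auto
      next
        case False
        then show ?thesis
          using ml_image_trace_0 [OF inf assms(1) a0 False]
            ml_image_trace_nonzero [OF inf quad assms(1) a0 b False] by blast
      qed
      then show ?thesis
        by blast
    qed
  qed
qed

end
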